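(* Let $(f,s)\colon(X,*,\circ)\rightleftarrows(Y,*,\circ)$ be any split epimorphism of digroups with kernel $(K,*,\circ)$, skewing index $\xi$ and canonical group actions $\phi_*\colon (Y,* )\to\mathrm{Aut}(K,* )$, $\phi_\circ\colon (Y,\circ)\to\mathrm{Aut}(K,\circ)$. On $Y\times K$ define $$(y,k)\ltimes_{\phi_*}(y',k')=(y*y',\,k*\phi_{*y}(k')),$$ $$(y,k)\circ_\xi(y',k')=\bigl(y\circ y',\ \xi_{y\circ y'}(\xi_y^{-1}(k)\circ\phi_{\circ y}(\xi_{y'}^{-1}(k')))\bigr).$$ Then $(f,s)$ is isomorphic, in the category of digroups, to the split epimorphism $(p_Y,\iota_Y)\colon(Y\times K,\ltimes_{\phi_*},\circ_\xi)\rightleftarrows(Y,*,\circ)$, where $p_Y(y,k)=y$ and $\iota_Y(y)=(y,1)$; that is, there is a digroup isomorphism $\theta\colon (Y\times K,\ltimes_{\phi_*},\circ_\xi)\to (X,*,\circ)$ with $f\theta=p_Y$ and $\theta\iota_Y=s$.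
   Context: A digroup $(X,*,\circ)$ is a set with two group structures having the same unit $1$; morphisms are maps that are homomorphisms for both laws. $x^{-*}$ and $x^{-\circ}$ denote the inverses for $*$ and $\circ$. A split epimorphism $(f,s)\colon X\rightleftarrows Y$ consists of morphisms $f\colon X\to Y$, $s\colon Y\to X$ with $fs=\mathrm{Id}_Y$; $K=f^{-1}(1)$ is its kernel. Canonical actions: $\phi_{*y}(k)=s(y)*k*s(y)^{-*}$ and $\phi_{\circ y}(k)=s(y)\circ k\circ s(y)^{-\circ}$. Skewing index: the map $\xi$ from $Y$ to the permutations of $K$ given by $\xi_y(k)=(k\circ s(y))*s(y)^{-*}$ (each $\xi_y$ is a bijection of $K$ fixing $1$, and $\xi_1=\mathrm{Id}_K$). *)

theory Defs
  imports "HOL-Algebra.Coset" "HOL-Algebra.Bij"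
begin

text \<open>
  A digroup \<open>(X, *, \<circ>)\<close> is a record whose underlying monoid fields carry the law \<open>*\<close>;
  \<open>circ_group X\<close> is the same set with the law \<open>\<circ>\<close>. There is only one field for the unit, so both
  laws have the same unit.
\<close>

record 'a digroup = "'a monoid" +
  circ :: "'a \<Rightarrow> 'a \<Rightarrow> 'a"

definition circ_group :: "'a digroup \<Rightarrow> 'a monoid"
  where "circ_group X = \<lparr>carrier = carrier X, mult = circ X, one = \<one>\<^bsub>X\<^esub>\<rparr>"

lemma circ_group_simps [simp]:
  "carrier (circ_group X) = carrier X"
  "x \<otimes>\<^bsub>circ_group X\<^esub> y = circ X x y"
  "\<one>\<^bsub>circ_group X\<^esub> = \<one>\<^bsub>X\<^esub>"
  by (simp_all add: circ_group_def)

definition digroup :: "'a digroup \<Rightarrow> bool"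
  where "digroup X \<longleftrightarrow> group X \<and> group (circ_group X)"

definition digroup_hom :: "'a digroup \<Rightarrow> 'b digroup \<Rightarrow> ('a \<Rightarrow> 'b) set"
  where "digroup_hom X Y = hom X Y \<inter> hom (circ_group X) (circ_group Y)"

definition digroup_iso :: "'a digroup \<Rightarrow> 'b digroup \<Rightarrow> ('a \<Rightarrow> 'b) set"
  where "digroup_iso X Y = iso X Y \<inter> iso (circ_group X) (circ_group Y)"

definition split_epi :: "'a digroup \<Rightarrow> 'b digroup \<Rightarrow> ('a \<Rightarrow> 'b) \<Rightarrow> ('b \<Rightarrow> 'a) \<Rightarrow> bool"
  where "split_epi X Y f s \<longleftrightarrow> digroup X \<and> digroup Y \<and>
    f \<in> digroup_hom X Y \<and> s \<in> digroup_hom Y X \<and> (\<forall>y\<in>carrier Y. f (s y) = y)"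

definition kernel_digroup :: "'a digroup \<Rightarrow> 'b digroup \<Rightarrow> ('a \<Rightarrow> 'b) \<Rightarrow> 'a digroup"
  where "kernel_digroup X Y f = X\<lparr>carrier := kernel X Y f\<rparr>"

text \<open>
  The action by conjugation attached to a split epimorphism of groups. It is instantiated at
  \<open>X\<close>, \<open>Y\<close> for \<open>\<phi>\<^sub>*\<close> and at \<open>circ_group X\<close>, \<open>circ_group Y\<close> for \<open>\<phi>\<^sub>\<circ>\<close>. As usual for the
  permutations in \<open>Bij\<close>, the values are functions restricted to the kernel.
\<close>

definition canonical_action ::
  "('a, 'm) monoid_scheme \<Rightarrow> ('b, 'n) monoid_scheme \<Rightarrow> ('a \<Rightarrow> 'b) \<Rightarrow> ('b \<Rightarrow> 'a) \<Rightarrow> 'b \<Rightarrow> 'a \<Rightarrow> 'a"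
  where "canonical_action G H f s y =
    (\<lambda>k \<in> kernel G H f. s y \<otimes>\<^bsub>G\<^esub> k \<otimes>\<^bsub>G\<^esub> inv\<^bsub>G\<^esub> (s y))"

definition skewing_index ::
  "'a digroup \<Rightarrow> 'b digroup \<Rightarrow> ('a \<Rightarrow> 'b) \<Rightarrow> ('b \<Rightarrow> 'a) \<Rightarrow> 'b \<Rightarrow> 'a \<Rightarrow> 'a"
  where "skewing_index X Y f s y =
    (\<lambda>k \<in> kernel X Y f. circ X k (s y) \<otimes>\<^bsub>X\<^esub> inv\<^bsub>X\<^esub> (s y))"

definition skew_product ::
  "'b digroup \<Rightarrow> 'a digroup \<Rightarrow> ('b \<Rightarrow> 'a \<Rightarrow> 'a) \<Rightarrow> ('b \<Rightarrow> 'a \<Rightarrow> 'a) \<Rightarrow> ('b \<Rightarrow> 'a \<Rightarrow> 'a) \<Rightarrow> ('b \<times> 'a) digroup"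
  where "skew_product Y K \<phi> \<psi> \<xi> =
    \<lparr>carrier = carrier Y \<times> carrier K,
     mult = (\<lambda>(y, k) (y', k'). (y \<otimes>\<^bsub>Y\<^esub> y', k \<otimes>\<^bsub>K\<^esub> \<phi> y k')),
     one = (\<one>\<^bsub>Y\<^esub>, \<one>\<^bsub>K\<^esub>),
     circ = (\<lambda>(y, k) (y', k').
       (circ Y y y',
        \<xi> (circ Y y y')
          (circ K (inv_into (carrier K) (\<xi> y) k)
                  (\<psi> y (inv_into (carrier K) (\<xi> y') k')))))\<rparr>"

text \<open>
  The kernel is a digroup, the canonical actions are group actions by automorphisms, and the skewing
  index takes values in the permutations of the kernel fixing the unit.
\<close>

lemma digroup_kernel:
  assumes "split_epi X Y f s"
  shows "digroup (kernel_digroup X Y f)"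
proof -
  have "group_hom X Y f" "group_hom (circ_group X) (circ_group Y) f"
    using assms by (auto simp: split_epi_def digroup_def digroup_hom_def
        intro!: group_hom.intro group_hom_axioms.intro)
  then have "subgroup (kernel X Y f) X"
    "subgroup (kernel (circ_group X) (circ_group Y) f) (circ_group X)"
    by (auto intro: group_hom.subgroup_kernel)
  moreover have "circ_group (kernel_digroup X Y f) =
      circ_group X\<lparr>carrier := kernel (circ_group X) (circ_group Y) f\<rparr>"
    by (simp add: circ_group_def kernel_digroup_def kernel_def)
  ultimately show ?thesis
    using assms
    by (auto simp: split_epi_def digroup_def kernel_digroup_def intro: subgroup.subgroup_is_group)
qed

lemma canonical_action_hom:
  assumes "group G" "group H" "f \<in> hom G H" "s \<in> hom H G" "\<And>y. y \<in> carrier H \<Longrightarrow> f (s y) = y"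
  shows "canonical_action G H f s \<in> hom H (AutoGroup (G\<lparr>carrier := kernel G H f\<rparr>))"
proof -
  interpret f: group_hom G H f
    using assms by (auto intro!: group_hom.intro group_hom_axioms.intro)
  interpret s: group_hom H G s
    using assms by (auto intro!: group_hom.intro group_hom_axioms.intro)
  let ?K = "kernel G H f" and ?\<phi> = "canonical_action G H f s"
  have KG: "k \<in> carrier G" if "k \<in> ?K" for k
    using that by (simp add: kernel_def)
  have \<phi>K: "?\<phi> y k \<in> ?K" if "y \<in> carrier H" "k \<in> ?K" for y k
    using that by (simp add: canonical_action_def kernel_def)
  have mult: "?\<phi> (y \<otimes>\<^bsub>H\<^esub> z) k = ?\<phi> y (?\<phi> z k)"
    if "y \<in> carrier H" "z \<in> carrier H" "k \<in> ?K" for y z k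
    using that \<phi>K[of z k] KG[of k]
    by (simp add: canonical_action_def f.G.inv_mult_group f.G.m_assoc)
  have one: "?\<phi> \<one>\<^bsub>H\<^esub> k = k" if "k \<in> ?K" for k
    using that KG[of k] by (simp add: canonical_action_def)
  have "bij_betw (?\<phi> y) ?K ?K" if "y \<in> carrier H" for y
    by (rule bij_betw_byWitness[where f' = "?\<phi> (inv\<^bsub>H\<^esub> y)"])
      (use that in \<open>auto simp: mult[symmetric] one \<phi>K\<close>)
  then have Bij: "?\<phi> y \<in> Bij ?K" if "y \<in> carrier H" for y
    using that by (simp add: Bij_def canonical_action_def)
  have K: "subgroup ?K G" by (rule f.subgroup_kernel)
  have hom: "?\<phi> y (k \<otimes>\<^bsub>G\<^esub> l) = ?\<phi> y k \<otimes>\<^bsub>G\<^esub> ?\<phi> y l"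
    if "y \<in> carrier H" "k \<in> ?K" "l \<in> ?K" for y k l
    using that KG[of k] KG[of l] subgroup.m_closed[OF K that(2,3)]
    by (simp add: canonical_action_def f.G.m_assoc)
      (simp add: f.G.m_assoc[symmetric])
  have comp: "?\<phi> (y \<otimes>\<^bsub>H\<^esub> z) = compose ?K (?\<phi> y) (?\<phi> z)"
    if "y \<in> carrier H" "z \<in> carrier H" for y z
  proof
    fix k
    show "?\<phi> (y \<otimes>\<^bsub>H\<^esub> z) k = compose ?K (?\<phi> y) (?\<phi> z) k"
      using that mult[of y z k]
      by (cases "k \<in> ?K") (simp_all add: compose_def canonical_action_def)
  qed
  show ?thesis
    by (rule homI) (auto simp: AutoGroup_def auto_def hom_def BijGroup_def Bij hom \<phi>K comp)
qed

lemma skewing_index_Bij: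
  assumes "split_epi X Y f s" "y \<in> carrier Y"
  shows "skewing_index X Y f s y \<in> Bij (kernel X Y f)" "skewing_index X Y f s y \<one>\<^bsub>X\<^esub> = \<one>\<^bsub>X\<^esub>"
proof -
  have X: "group X" "group (circ_group X)" "group Y" "group (circ_group Y)"
    using assms by (auto simp: split_epi_def digroup_def)
  interpret S: group X by fact
  interpret C: group "circ_group X" by fact
  interpret SY: group Y by fact
  interpret CY: group "circ_group Y" by fact
  interpret f: group_hom X Y f
    using assms X by (auto simp: split_epi_def digroup_hom_def intro!: group_hom.intro group_hom_axioms.intro)
  interpret g: group_hom "circ_group X" "circ_group Y" f
    using assms X by (auto simp: split_epi_def digroup_hom_def intro!: group_hom.intro group_hom_axioms.intro)
  have sy: "s y \<in> carrier X" "f (s y) = y"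
    using assms by (auto simp: split_epi_def digroup_hom_def hom_def)
  let ?K = "kernel X Y f" and ?\<xi> = "skewing_index X Y f s y"
  define \<eta> where "\<eta> k = circ X (k \<otimes>\<^bsub>X\<^esub> s y) (inv\<^bsub>circ_group X\<^esub> (s y))" for k
  note [simp] = C.m_closed[simplified] C.inv_closed[simplified] C.m_assoc[simplified]
    C.r_inv[simplified] C.l_inv[simplified] C.r_one[simplified] C.l_one[simplified]
    g.hom_mult[simplified] g.hom_inv[simplified] CY.r_inv[simplified] CY.l_one[simplified]
  have KX: "k \<in> carrier X" if "k \<in> ?K" for k
    using that by (simp add: kernel_def)
  have \<xi>K: "?\<xi> k \<in> ?K" and \<eta>K: "\<eta> k \<in> ?K" if "k \<in> ?K" for k
    using that sy assms(2) by (simp_all add: skewing_index_def \<eta>_def kernel_def)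
  have "bij_betw ?\<xi> ?K ?K"
  proof (rule bij_betw_byWitness[where f' = \<eta>])
    show "\<forall>k\<in>?K. \<eta> (?\<xi> k) = k" "\<forall>k\<in>?K. ?\<xi> (\<eta> k) = k"
      using sy KX \<eta>K by (auto simp: skewing_index_def S.m_assoc) (auto simp: \<eta>_def S.m_assoc)
  qed (use \<xi>K \<eta>K in auto)
  then show "?\<xi> \<in> Bij ?K"
    by (simp add: Bij_def skewing_index_def)
  show "?\<xi> \<one>\<^bsub>X\<^esub> = \<one>\<^bsub>X\<^esub>"
    using sy by (simp add: skewing_index_def kernel_def)
qed

end

theory Submission
  imports Defs
begin

text \<open>
  The isomorphism is \<open>\<theta> (y, k) = k * s y\<close>. By the definition of the skewing index,
  \<open>\<theta> (y, k) = \<xi>\<^sub>y\<inverse>(k) \<circ> s y\<close> as well, so that \<open>\<theta>\<close> turns both laws on \<open>Y \<times> K\<close> into the usual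
  semidirect product computations in \<open>(X, *)\<close> and \<open>(X, \<circ>)\<close>. The group axioms for the two laws on
  \<open>Y \<times> K\<close> are transported back along \<open>\<theta>\<close>.
\<close>

text \<open>The group laws can be checked after applying the injective map \<open>h\<close>; a left
  inverse of \<open>x\<close> is a preimage of \<open>inv (h x)\<close>. Closure is a separate
  hypothesis because \<open>h \<in> iso G H\<close> only constrains \<open>h\<close> on the carrier,
  so a product in \<open>G\<close> could still fall outside it.\<close>

lemma group_iso_transport:
  assumes "group H" "h \<in> iso G H" "\<one>\<^bsub>G\<^esub> \<in> carrier G" "h \<one>\<^bsub>G\<^esub> = \<one>\<^bsub>H\<^esub>"
    and closed: "\<And>x y. \<lbrakk>x \<in> carrier G; y \<in> carrier G\<rbrakk> \<Longrightarrow> x \<otimes>\<^bsub>G\<^esub> y \<in> carrier G"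
  shows "group G"
proof -
  interpret H: group H by fact
  have hom: "h (x \<otimes>\<^bsub>G\<^esub> y) = h x \<otimes>\<^bsub>H\<^esub> h y" "h x \<in> carrier H"
    if "x \<in> carrier G" "y \<in> carrier G" for x y
    using assms(2) that by (auto simp: iso_def hom_def)
  have inj: "x = y" if "h x = h y" "x \<in> carrier G" "y \<in> carrier G" for x y
    using assms(2) that by (auto simp: iso_def bij_betw_def dest: inj_onD)
  show ?thesis
  proof (rule groupI)
    fix x assume x: "x \<in> carrier G"
    then have "inv\<^bsub>H\<^esub> (h x) \<in> h ` carrier G"
      using assms(2) hom(2)[OF x x] by (simp add: iso_def bij_betw_def)
    then obtain y where y: "y \<in> carrier G" "h y = inv\<^bsub>H\<^esub> (h x)"
      by auto
    then have "y \<otimes>\<^bsub>G\<^esub> x = \<one>\<^bsub>G\<^esub>"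
      using x assms(3,4) hom closed by (intro inj) simp_all
    with y show "\<exists>y\<in>carrier G. y \<otimes>\<^bsub>G\<^esub> x = \<one>\<^bsub>G\<^esub>"
      by blast
  qed (use assms(3,4) hom closed in \<open>auto intro!: inj simp: H.m_assoc\<close>)
qed

text \<open>As \<open>h\<close> is injective, multiplicativity of \<open>i\<close> can be tested
  after applying \<open>h\<close>, where it becomes that of \<open>s\<close>. This serves the
  section \<open>y \<mapsto> (y, 1)\<close> for both laws.\<close>

lemma hom_transport_section:
  assumes "h \<in> iso P G" "s \<in> hom H G" "group P" "group H"
    and "\<And>y. y \<in> carrier H \<Longrightarrow> i y \<in> carrier P"
    and "\<And>y. y \<in> carrier H \<Longrightarrow> h (i y) = s y"
  shows "i \<in> hom H P"
proof (rule homI)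
  interpret P: group P by fact
  interpret H: group H by fact
  fix y z assume yz: "y \<in> carrier H" "z \<in> carrier H"
  have eq: "h (i (y \<otimes>\<^bsub>H\<^esub> z)) = h (i y \<otimes>\<^bsub>P\<^esub> i z)"
    using assms yz hom_mult[of h P G "i y" "i z"] by (simp add: iso_def hom_mult[of s H G])
  have inj: "inj_on h (carrier P)"
    using assms by (simp add: iso_def bij_betw_def)
  show "i (y \<otimes>\<^bsub>H\<^esub> z) = i y \<otimes>\<^bsub>P\<^esub> i z"
    using assms(5) yz by (intro inj_onD[OF inj eq]) simp_all
qed (use assms in auto)

text \<open>On the carrier of \<open>P\<close> the map \<open>p\<close> is the composite
  \<open>f \<circ> h\<close>; products stay in that carrier, so multiplicativity passes to
  \<open>p\<close>.\<close>

lemma hom_transport_retraction: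
  assumes "h \<in> iso P G" "f \<in> hom G H" "group P"
    and "\<And>x. x \<in> carrier P \<Longrightarrow> f (h x) = p x"
  shows "p \<in> hom P H"
proof -
  interpret P: group P by fact
  have "f \<circ> h \<in> hom P H"
    using assms by (auto simp: iso_def intro: hom_compose)
  then show ?thesis
    using assms(4) by (auto simp: hom_def Pi_iff)
qed

theorem proposition2p2:
  fixes X :: "'a digroup" and Y :: "'b digroup" and f :: "'a \<Rightarrow> 'b" and s :: "'b \<Rightarrow> 'a"
  assumes "split_epi X Y f s"
  shows "let K = kernel_digroup X Y f;
             \<phi>_star = canonical_action X Y f s;
             \<phi>_circ = canonical_action (circ_group X) (circ_group Y) f s;
             \<xi> = skewing_index X Y f s;
             P = skew_product Y K \<phi>_star \<phi>_circ \<xi>;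
             p = (\<lambda>(y, k). y);
             \<iota> = (\<lambda>y. (y, \<one>\<^bsub>K\<^esub>))
         in split_epi P Y p \<iota> \<and>
            (\<exists>\<theta> \<in> digroup_iso P X.
               (\<forall>z\<in>carrier P. f (\<theta> z) = p z) \<and>
               (\<forall>y\<in>carrier Y. \<theta> (\<iota> y) = s y))"
proof -
  have X: "group X" "group (circ_group X)" and Y: "group Y" "group (circ_group Y)"
    using assms by (auto simp: split_epi_def digroup_def)
  have homs: "f \<in> hom X Y" "f \<in> hom (circ_group X) (circ_group Y)"
      "s \<in> hom Y X" "s \<in> hom (circ_group Y) (circ_group X)"
    using assms by (auto simp: split_epi_def digroup_hom_def)
  interpret S: group X by fact
  interpret C: group "circ_group X" by fact
  interpret SY: group Y by fact
  interpret CY: group "circ_group Y" by fact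
  interpret f: group_hom X Y f
    using X Y homs by (auto intro!: group_hom.intro group_hom_axioms.intro)
  interpret g: group_hom "circ_group X" "circ_group Y" f
    using X Y homs by (auto intro!: group_hom.intro group_hom_axioms.intro)
  interpret s: group_hom Y X s
    using X Y homs by (auto intro!: group_hom.intro group_hom_axioms.intro)
  interpret t: group_hom "circ_group Y" "circ_group X" s
    using X Y homs by (auto intro!: group_hom.intro group_hom_axioms.intro)
  define K where "K = kernel_digroup X Y f"
  define \<phi> where "\<phi> = canonical_action X Y f s"
  define \<psi> where "\<psi> = canonical_action (circ_group X) (circ_group Y) f s"
  define \<xi> where "\<xi> = skewing_index X Y f s"
  define P where "P = skew_product Y K \<phi> \<psi> \<xi>"
  define \<theta> where "\<theta> = (\<lambda>(y, k). k \<otimes>\<^bsub>X\<^esub> s y)"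
  let ?\<eta> = "\<lambda>y. inv_into (carrier K) (\<xi> y)"
  have circ_assoc: "circ X (circ X x y) z = circ X x (circ X y z)"
    if "x \<in> carrier X" "y \<in> carrier X" "z \<in> carrier X" for x y z
    using C.m_assoc that by simp
  \<comment> \<open>Simp turns the operations of \<open>circ_group X\<close> into
    \<open>circ X\<close>, so the group facts are restated in that form. Associativity stays out of
    the simp set, since it is used below in both directions.\<close>
  note [simp] = C.m_closed[simplified] C.inv_closed[simplified]
    C.r_inv[simplified] C.l_inv[simplified] C.r_one[simplified] C.l_one[simplified]
    g.hom_mult[simplified] g.hom_inv[simplified] t.hom_mult[simplified]
    CY.m_closed[simplified] CY.r_inv[simplified] CY.l_one[simplified] CY.r_one[simplified]
  have fs [simp]: "f (s y) = y" if "y \<in> carrier Y" for y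
    using assms that by (auto simp: split_epi_def)
  have K: "mult K = mult X" "circ K = circ X" "\<one>\<^bsub>K\<^esub> = \<one>\<^bsub>X\<^esub>"
    and carrier_K: "carrier K = kernel X Y f"
    by (simp_all add: K_def kernel_digroup_def)
  have KI: "k \<in> carrier K" if "k \<in> carrier X" "f k = \<one>\<^bsub>Y\<^esub>" for k
    using that by (simp add: carrier_K kernel_def)
  have KD [simp]: "k \<in> carrier X" "f k = \<one>\<^bsub>Y\<^esub>" if "k \<in> carrier K" for k
    using that by (simp_all add: carrier_K kernel_def)
  have P: "carrier P = carrier Y \<times> carrier K" "\<one>\<^bsub>P\<^esub> = (\<one>\<^bsub>Y\<^esub>, \<one>\<^bsub>X\<^esub>)"
    by (simp_all add: P_def skew_product_def K)
  \<comment> \<open>The formula for \<open>\<psi>\<close> relies on the kernels for the two laws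
    being the same set, as both laws share one unit.\<close>
  have \<phi>: "\<phi> y k = s y \<otimes>\<^bsub>X\<^esub> k \<otimes>\<^bsub>X\<^esub> inv\<^bsub>X\<^esub> (s y)"
    and \<psi>: "\<psi> y k = circ X (circ X (s y) k) (inv\<^bsub>circ_group X\<^esub> (s y))"
    if "k \<in> carrier K" for y k
    using that by (simp_all add: \<phi>_def \<psi>_def canonical_action_def carrier_K kernel_def del: KD)
  have bij: "bij_betw (\<xi> y) (carrier K) (carrier K)" if "y \<in> carrier Y" for y
    using skewing_index_Bij(1)[OF assms that] by (simp add: \<xi>_def carrier_K Bij_def)
  have \<eta>K: "?\<eta> y k \<in> carrier K" and \<xi>\<eta>: "\<xi> y (?\<eta> y k) = k"
    if "y \<in> carrier Y" "k \<in> carrier K" for y k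
    using bij[OF that(1)] that(2) by (auto simp: bij_betw_def intro: inv_into_into f_inv_into_f)
  \<comment> \<open>The value \<open>\<xi> y a\<close> ends in the \<open>*\<close>-inverse of
    \<open>s y\<close>, which cancels against the factor \<open>s y\<close> added by
    \<open>\<theta>\<close>. This is the bridge from \<open>*\<close> to
    \<open>\<circ>\<close>.\<close>
  have \<theta>_\<xi>: "\<theta> (y, \<xi> y a) = circ X a (s y)" if "y \<in> carrier Y" "a \<in> carrier K" for y a
    using that by (simp add: \<theta>_def \<xi>_def skewing_index_def carrier_K[symmetric] S.m_assoc)
  have \<theta>_\<eta>: "\<theta> (y, k) = circ X (?\<eta> y k) (s y)" if "y \<in> carrier Y" "k \<in> carrier K" for y k
    using that \<theta>_\<xi>[of y "?\<eta> y k"] \<eta>K \<xi>\<eta> by simp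
  have \<phi>K: "\<phi> y k \<in> carrier K" and \<psi>K: "\<psi> y k \<in> carrier K"
    if "y \<in> carrier Y" "k \<in> carrier K" for y k
    using that by (auto intro!: KI simp: \<phi> \<psi>)
  have \<theta>X: "\<theta> z \<in> carrier X" and f\<theta>: "f (\<theta> z) = fst z" if "z \<in> carrier P" for z
    using that by (auto simp: P \<theta>_def)
  have bij_\<theta>: "bij_betw \<theta> (carrier P) (carrier X)"
  \<comment> \<open>Every \<open>x\<close> is the \<open>*\<close>-product of
    \<open>x * inv (s (f x))\<close>, which \<open>f\<close> sends to the unit, and
    \<open>s (f x)\<close>.\<close>
  proof (rule bij_betw_byWitness[where f' = "\<lambda>x. (f x, x \<otimes>\<^bsub>X\<^esub> inv\<^bsub>X\<^esub> (s (f x)))"])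
    show "\<forall>z\<in>carrier P. (f (\<theta> z), \<theta> z \<otimes>\<^bsub>X\<^esub> inv\<^bsub>X\<^esub> (s (f (\<theta> z)))) = z"
      by (auto simp: P \<theta>_def S.m_assoc)
  qed (auto simp: P \<theta>_def S.m_assoc intro!: KI)
  have star_hom: "\<theta> (y \<otimes>\<^bsub>Y\<^esub> y', k \<otimes>\<^bsub>X\<^esub> \<phi> y k') = \<theta> (y, k) \<otimes>\<^bsub>X\<^esub> \<theta> (y', k')"
    and star_closed: "k \<otimes>\<^bsub>X\<^esub> \<phi> y k' \<in> carrier K"
    if "y \<in> carrier Y" "k \<in> carrier K" "y' \<in> carrier Y" "k' \<in> carrier K" for y k y' k'
  proof -
    show "k \<otimes>\<^bsub>X\<^esub> \<phi> y k' \<in> carrier K"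
      using that \<phi>K by (auto intro!: KI)
    \<comment> \<open>The inverse of \<open>s y\<close> closing the conjugate
      \<open>\<phi> y k'\<close> meets \<open>s (y * y') = s y * s y'\<close>; what remains is
      \<open>k * s y * k' * s y'\<close>.\<close>
    have "inv\<^bsub>X\<^esub> (s y) \<otimes>\<^bsub>X\<^esub> (s y \<otimes>\<^bsub>X\<^esub> s y') = s y'"
      using that by (simp add: S.m_assoc[symmetric])
    then show "\<theta> (y \<otimes>\<^bsub>Y\<^esub> y', k \<otimes>\<^bsub>X\<^esub> \<phi> y k') = \<theta> (y, k) \<otimes>\<^bsub>X\<^esub> \<theta> (y', k')"
      using that by (simp add: \<theta>_def \<phi> S.m_assoc)
  qed
  have iso: "\<theta> \<in> iso P X"
  proof (rule isoI)
    show "\<theta> \<in> hom P X"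
      using \<theta>X star_hom by (intro homI) (auto simp: P_def skew_product_def K)
  qed (rule bij_\<theta>)
  have circ_hom: "\<theta> (circ Y y y', \<xi> (circ Y y y') (circ X (?\<eta> y k) (\<psi> y (?\<eta> y' k')))) =
      circ X (\<theta> (y, k)) (\<theta> (y', k'))"
    and circ_closed: "\<xi> (circ Y y y') (circ X (?\<eta> y k) (\<psi> y (?\<eta> y' k'))) \<in> carrier K"
    if yk: "y \<in> carrier Y" "k \<in> carrier K" "y' \<in> carrier Y" "k' \<in> carrier K" for y k y' k'
  proof -
    let ?a = "?\<eta> y k" and ?b = "?\<eta> y' k'"
    have ab: "?a \<in> carrier K" "?b \<in> carrier K"
      using yk \<eta>K by auto
    then have ab': "circ X ?a (\<psi> y ?b) \<in> carrier K"
      using yk \<psi>K by (auto intro!: KI)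
    then show "\<xi> (circ Y y y') (circ X ?a (\<psi> y ?b)) \<in> carrier K"
      using yk bij[of "circ Y y y'"] by (auto simp: bij_betw_def)
    \<comment> \<open>The outer \<open>\<xi>\<close> is taken at \<open>y \<circ> y'\<close>,
      exactly the first component, so \<open>\<theta>\<close> absorbs it. The rest is the semidirect
      product computation in \<open>(X, \<circ>)\<close>, with \<open>?a\<close> and
      \<open>?b\<close> as kernel parts.\<close>
    have "\<theta> (circ Y y y', \<xi> (circ Y y y') (circ X ?a (\<psi> y ?b))) =
        circ X (circ X ?a (\<psi> y ?b)) (circ X (s y) (s y'))"
      using yk ab' by (simp add: \<theta>_\<xi>)
    moreover have "circ X (inv\<^bsub>circ_group X\<^esub> (s y)) (circ X (s y) (s y')) = s y'"
      using yk by (simp add: circ_assoc[symmetric])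
    ultimately show "\<theta> (circ Y y y', \<xi> (circ Y y y') (circ X ?a (\<psi> y ?b))) =
        circ X (\<theta> (y, k)) (\<theta> (y', k'))"
      using yk ab by (simp add: \<theta>_\<eta> \<psi> circ_assoc)
  qed
  have iso_circ: "\<theta> \<in> iso (circ_group P) (circ_group X)"
  proof (rule isoI)
    show "\<theta> \<in> hom (circ_group P) (circ_group X)"
      using \<theta>X circ_hom by (intro homI) (auto simp: P_def skew_product_def K)
  qed (simp add: bij_\<theta>)
  have one: "\<one>\<^bsub>P\<^esub> \<in> carrier P" "\<theta> \<one>\<^bsub>P\<^esub> = \<one>\<^bsub>X\<^esub>"
    by (auto simp: P \<theta>_def intro!: KI)
  \<comment> \<open>These closure facts are the remaining input for transporting both group
    structures back along \<open>\<theta>\<close>.\<close>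
  have "z \<otimes>\<^bsub>P\<^esub> w \<in> carrier P" "circ P z w \<in> carrier P"
    if "z \<in> carrier P" "w \<in> carrier P" for z w
    using that star_closed circ_closed by (auto simp: P_def skew_product_def K)
  then have group_P: "group P" "group (circ_group P)"
    using group_iso_transport[OF X(1) iso one]
      group_iso_transport[OF X(2) iso_circ] one by simp_all
  have \<iota>: "(y, \<one>\<^bsub>X\<^esub>) \<in> carrier P" "\<theta> (y, \<one>\<^bsub>X\<^esub>) = s y" if "y \<in> carrier Y" for y
    using that by (auto simp: P \<theta>_def intro!: KI)
  have "fst \<in> hom P Y" "fst \<in> hom (circ_group P) (circ_group Y)"
    using hom_transport_retraction[OF iso homs(1) group_P(1)]
      hom_transport_retraction[OF iso_circ homs(2) group_P(2)] f\<theta> by simp_all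
  moreover have "(\<lambda>y. (y, \<one>\<^bsub>X\<^esub>)) \<in> hom Y P"
      "(\<lambda>y. (y, \<one>\<^bsub>X\<^esub>)) \<in> hom (circ_group Y) (circ_group P)"
    using hom_transport_section[OF iso homs(3) group_P(1) Y(1)]
      hom_transport_section[OF iso_circ homs(4) group_P(2) Y(2)] \<iota> by simp_all
  ultimately have "split_epi P Y fst (\<lambda>y. (y, \<one>\<^bsub>X\<^esub>))"
    using group_P Y by (simp add: split_epi_def digroup_def digroup_hom_def)
  moreover have "\<theta> \<in> digroup_iso P X"
    using iso iso_circ by (simp add: digroup_iso_def)
  moreover have "(\<lambda>(y, k). y) = (fst :: 'b \<times> 'a \<Rightarrow> 'b)"
    by auto
  ultimately show ?thesis
    unfolding Let_def K_def[symmetric] \<phi>_def[symmetric] \<psi>_def[symmetric] \<xi>_def[symmetric]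
      P_def[symmetric] K(3)
    using f\<theta> \<iota> by (auto intro!: bexI[of _ \<theta>])
qed

end
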